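(* Let $(X,T)$ be a minimal dynamical system. Then $(X,T)$ is either mean equicontinuous or mean sensitive.
   Context: A dynamical system $(X,T)$ is a compact metric space $(X,d)$ together with a continuous map $T\colon X\to X$. $B(x,\varepsilon)$ is the open ball. $\omega(x,T)=\bigcap_{N\ge0}\overline{\{T^nx\colon n\ge N\}}$. $(X,T)$ is minimal if $\omega(x,T)=X$ for every $x\in X$. $(X,T)$ is mean equicontinuous if for every $\varepsilon>0$ there is $\delta>0$ such that for all $x,y\in X$ with $d(x,y)<\delta$, $\limsup_{n\to\infty}\frac1n\sum_{i=0}^{n-1}d(T^ix,T^iy)<\varepsilon$. $(X,T)$ is mean sensitive if there is $\delta>0$ such that for every $x\in X$ and every $\varepsilon>0$ there is $y\in B(x,\varepsilon)$ with $\limsup_{n\to\infty}\frac1n\sum_{i=0}^{n-1}d(T^ix,T^iy)>\delta$. *)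

theory Defs
  imports "HOL-Analysis.Analysis"
begin

text \<open>
  The phase space is a compact subset \<open>X\<close> of an ambient metric space, with the induced
  metric. The empty set is not excluded.
\<close>

definition dynamical_system :: "'a::metric_space set \<Rightarrow> ('a \<Rightarrow> 'a) \<Rightarrow> bool" where
  "dynamical_system X T \<longleftrightarrow> compact X \<and> continuous_on X T \<and> T ` X \<subseteq> X"

text \<open>
  The closure is taken in the ambient space. For \<open>x \<in> X\<close> this agrees with the closure in \<open>X\<close>,
  because \<open>X\<close> is closed and invariant under \<open>T\<close>.
\<close>

definition omega_limit :: "('a::metric_space \<Rightarrow> 'a) \<Rightarrow> 'a \<Rightarrow> 'a set" where
  "omega_limit T x = (\<Inter>N::nat. closure {(T ^^ n) x | n. n \<ge> N})"

definition minimal_system :: "'a::metric_space set \<Rightarrow> ('a \<Rightarrow> 'a) \<Rightarrow> bool" where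
  "minimal_system X T \<longleftrightarrow> dynamical_system X T \<and> (\<forall>x\<in>X. omega_limit T x = X)"

text \<open>
  The upper limit is taken in \<open>ereal\<close>, where it always exists. On a compact \<open>X\<close> the averages are
  bounded, so there it is the usual real upper limit. The term for \<open>n = 0\<close> is \<open>0\<close>.
\<close>

definition mean_dist :: "('a::metric_space \<Rightarrow> 'a) \<Rightarrow> 'a \<Rightarrow> 'a \<Rightarrow> ereal" where
  "mean_dist T x y =
     limsup (\<lambda>n. ereal (1 / real n * (\<Sum>i<n. dist ((T ^^ i) x) ((T ^^ i) y))))"

definition mean_equicontinuous :: "'a::metric_space set \<Rightarrow> ('a \<Rightarrow> 'a) \<Rightarrow> bool" where
  "mean_equicontinuous X T \<longleftrightarrow>
     (\<forall>\<epsilon>::real>0. \<exists>\<delta>::real>0. \<forall>x\<in>X. \<forall>y\<in>X. dist x y < \<delta> \<longrightarrow> mean_dist T x y < ereal \<epsilon>)"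

definition mean_sensitive :: "'a::metric_space set \<Rightarrow> ('a \<Rightarrow> 'a) \<Rightarrow> bool" where
  "mean_sensitive X T \<longleftrightarrow>
     (\<exists>\<delta>::real>0. \<forall>x\<in>X. \<forall>\<epsilon>::real>0. \<exists>y \<in> ball x \<epsilon> \<inter> X. mean_dist T x y > ereal \<delta>)"

end

theory Submission
  imports Defs
begin

text \<open>
  If mean sensitivity fails at scale \<open>\<epsilon>/4\<close>, then some ball \<open>U\<close> has pairwise mean distances at most
  \<open>\<epsilon>/2\<close>. By minimality the sets \<open>(T ^^ n) -` U\<close> cover \<open>X\<close>, so points closer than a Lebesgue number
  of this cover are moved into \<open>U\<close> by a common iterate, and passing to an iterate does not decrease
  the mean distance.
\<close>

lemma mean_dist_commute: "mean_dist T x y = mean_dist T y x"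
  unfolding mean_dist_def by (simp add: dist_commute)

text \<open>The averages satisfy the triangle inequality for each \<open>n\<close>, and upper limits
  are subadditive. This compares two points of a ball through its centre.\<close>

lemma mean_dist_triangle: "mean_dist T x z \<le> mean_dist T x y + mean_dist T y z"
proof -
  let ?a = "\<lambda>x y n. 1 / real n * (\<Sum>i<n. dist ((T ^^ i) x) ((T ^^ i) y))"
  have "?a x z n \<le> 1 / real n * ((\<Sum>i<n. dist ((T ^^ i) x) ((T ^^ i) y)) +
      (\<Sum>i<n. dist ((T ^^ i) y) ((T ^^ i) z)))" for n
    unfolding sum.distrib[symmetric]
    by (intro mult_left_mono sum_mono dist_triangle) simp
  then have "ereal (?a x z n) \<le> ereal (?a x y n) + ereal (?a y z n)" for n
    unfolding plus_ereal.simps ereal_less_eq distrib_left .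
  then have "mean_dist T x z \<le> limsup (\<lambda>n. ereal (?a x y n) + ereal (?a y z n))"
    unfolding mean_dist_def by (intro Limsup_mono always_eventually allI)
  also have "\<dots> \<le> mean_dist T x y + mean_dist T y z"
    unfolding mean_dist_def by (rule ereal_limsup_add_mono)
  finally show ?thesis .
qed

text \<open>The first \<open>k\<close> distances have a fixed sum, whose share of the average
  vanishes after division by \<open>n\<close>; the rest is the average along the shifted
  orbits.\<close>

lemma mean_dist_le_funpow: "mean_dist T x y \<le> mean_dist T ((T ^^ k) x) ((T ^^ k) y)"
proof -
  define d where "d i = dist ((T ^^ i) x) ((T ^^ i) y)" for i
  \<comment> \<open>Lengthening the sum to \<open>n + k\<close> terms leaves exactly
    \<open>n\<close> terms after the shift, so the divisor \<open>n\<close> fits both sides.\<close>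
  have "(\<Sum>i<n. d i) \<le> (\<Sum>i<n + k. d i)" for n
    by (intro sum_mono2) (auto simp: d_def)
  also have "(\<Sum>i<n + k. d i) = (\<Sum>i<k. d i) + (\<Sum>i<n. d (i + k))" for n
    by (induction n) (simp_all add: algebra_simps)
  finally have "1 / real n * (\<Sum>i<n. d i) \<le>
      1 / real n * ((\<Sum>i<k. d i) + (\<Sum>i<n. d (i + k)))" for n
    by (intro mult_left_mono) auto
  then have le: "ereal (1 / real n * (\<Sum>i<n. d i)) \<le>
      ereal (1 / real n * (\<Sum>i<k. d i)) + ereal (1 / real n * (\<Sum>i<n. d (i + k)))" for n
    unfolding plus_ereal.simps ereal_less_eq distrib_left .
  have "(\<lambda>n. 1 / real n * (\<Sum>i<k. d i)) \<longlonglongrightarrow> 0"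
    by (intro tendsto_mult_left_zero lim_1_over_n)
  then have lim: "(\<lambda>n. ereal (1 / real n * (\<Sum>i<k. d i))) \<longlonglongrightarrow> 0"
    unfolding zero_ereal_def by (rule tendsto_ereal)
  have "mean_dist T x y = limsup (\<lambda>n. ereal (1 / real n * (\<Sum>i<n. d i)))"
    by (simp add: mean_dist_def d_def)
  also have "\<dots> \<le> limsup (\<lambda>n. ereal (1 / real n * (\<Sum>i<k. d i)) +
      ereal (1 / real n * (\<Sum>i<n. d (i + k))))"
    using le by (intro Limsup_mono always_eventually allI)
  \<comment> \<open>A summand converging to a finite limit, here 0, can be pulled out of the upper
    limit.\<close>
  also have "\<dots> = limsup (\<lambda>n. ereal (1 / real n * (\<Sum>i<n. d (i + k))))"
    by (subst ereal_limsup_lim_add[OF lim]) simp_all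
  also have "\<dots> = mean_dist T ((T ^^ k) x) ((T ^^ k) y)"
    by (simp add: mean_dist_def d_def funpow_add)
  finally show ?thesis .
qed

lemma funpow_image_subset: "T ` X \<subseteq> X \<Longrightarrow> (T ^^ n) ` X \<subseteq> X"
  by (induction n) auto

lemma continuous_on_funpow:
  assumes "continuous_on X T" "T ` X \<subseteq> X"
  shows "continuous_on X (T ^^ n)"
proof (induction n)
  case (Suc n)
  show ?case
    using continuous_on_compose[OF Suc continuous_on_subset[OF assms(1)]]
      funpow_image_subset[OF assms(2)] by simp
qed simp

text \<open>The index \<open>N = 0\<close> in the intersection shows that the whole orbit is dense
  in \<open>X\<close>, and an open set that meets the closure of the orbit meets the orbit.\<close>

lemma minimal_system_visits_open:
  assumes "minimal_system X T" "x \<in> X" "open U" "U \<inter> X \<noteq> {}"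
  obtains n where "(T ^^ n) x \<in> U"
proof -
  have "omega_limit T x = X"
    using assms(1,2) by (simp add: minimal_system_def)
  moreover have "omega_limit T x \<subseteq> closure {(T ^^ n) x | n. n \<ge> 0}"
    unfolding omega_limit_def by blast
  ultimately have "U \<inter> closure {(T ^^ n) x | n. n \<ge> 0} \<noteq> {}"
    using assms(4) by auto
  then show thesis
    using open_Int_closure_eq_empty[OF assms(3)] that by blast
qed

lemma minimal_system_common_visit:
  assumes X: "minimal_system X T" and U: "open U" "U \<inter> X \<noteq> {}"
  shows "\<exists>\<delta>>0. \<forall>x\<in>X. \<forall>y\<in>X. dist x y < \<delta> \<longrightarrow> (\<exists>n. (T ^^ n) x \<in> U \<and> (T ^^ n) y \<in> U)"
proof -
  have "compact X" "continuous_on X T" "T ` X \<subseteq> X"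
    using X by (auto simp: minimal_system_def dynamical_system_def)
  \<comment> \<open>The preimages of \<open>U\<close> are open only relative to \<open>X\<close>;
    the covering lemma works with open sets of the ambient space, so each is replaced by one with
    the same trace on \<open>X\<close>.\<close>
  then have "\<exists>V. open V \<and> V \<inter> X = (T ^^ n) -` U \<inter> X" for n
    using continuous_on_funpow[of X T n] U(1) by (simp add: continuous_on_open_invariant)
  then obtain V where V: "\<And>n. open (V n)" "\<And>n. V n \<inter> X = (T ^^ n) -` U \<inter> X"
    by metis
  have cover: "X \<subseteq> \<Union> (range V)"
  proof
    fix x assume "x \<in> X"
    then obtain n where "(T ^^ n) x \<in> U"
      using minimal_system_visits_open[OF X _ U] by blast
    then show "x \<in> \<Union> (range V)"
      using V(2)[of n] \<open>x \<in> X\<close> by blast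
  qed
  \<comment> \<open>\<open>\<delta>\<close> is a Lebesgue number of the cover: the whole ball around
    \<open>x\<close>, hence also \<open>y\<close>, lies in a single \<open>V n\<close>, which yields
    the common iterate.\<close>
  obtain \<delta> where \<delta>: "\<delta> > 0" "\<And>x. x \<in> X \<Longrightarrow> \<exists>G\<in>range V. ball x \<delta> \<subseteq> G"
    using V(1) by (auto intro: Heine_Borel_lemma[OF \<open>compact X\<close> cover])
  show ?thesis
  proof (intro exI[of _ \<delta>] conjI ballI impI \<delta>(1))
    fix x y assume "x \<in> X" "y \<in> X" "dist x y < \<delta>"
    moreover from this obtain n where "ball x \<delta> \<subseteq> V n"
      using \<delta>(2)[of x] by blast
    ultimately have "x \<in> V n \<inter> X" "y \<in> V n \<inter> X"
      using \<delta>(1) by auto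
    then show "\<exists>n. (T ^^ n) x \<in> U \<and> (T ^^ n) y \<in> U"
      unfolding V(2) by blast
  qed
qed

theorem corollary5p5:
  fixes X :: "'a::metric_space set" and T :: "'a \<Rightarrow> 'a"
  assumes "minimal_system X T"
  shows "(mean_equicontinuous X T \<or> mean_sensitive X T) \<and>
         (X \<noteq> {} \<longrightarrow> \<not> (mean_equicontinuous X T \<and> mean_sensitive X T))"
proof
  have inv: "(T ^^ n) x \<in> X" if "x \<in> X" for n x
    using assms that funpow_image_subset
    unfolding minimal_system_def dynamical_system_def by blast
  have "mean_equicontinuous X T" if ns: "\<not> mean_sensitive X T"
    unfolding mean_equicontinuous_def
  proof (intro allI impI)
    fix \<epsilon> :: real assume "\<epsilon> > 0"
    \<comment> \<open>Two non-strict bounds by \<open>\<epsilon> / 4\<close> add up to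
      \<open>\<epsilon> / 2\<close>, which leaves room for the strict inequality in
      \<open>mean_equicontinuous\<close>.\<close>
    then have "\<epsilon> / 4 > 0" by simp
    then obtain z r where z: "z \<in> X" "r > 0"
      and zr: "\<And>y. y \<in> ball z r \<inter> X \<Longrightarrow> mean_dist T z y \<le> ereal (\<epsilon> / 4)"
      using ns unfolding mean_sensitive_def by (meson not_le)
    then have "z \<in> ball z r \<inter> X" by simp
    then have ne: "ball z r \<inter> X \<noteq> {}" by blast
    obtain \<delta> where \<delta>: "\<delta> > 0"
      "\<And>x y. x \<in> X \<Longrightarrow> y \<in> X \<Longrightarrow> dist x y < \<delta> \<Longrightarrow>
         \<exists>n. (T ^^ n) x \<in> ball z r \<and> (T ^^ n) y \<in> ball z r"
      using minimal_system_common_visit[OF assms open_ball ne] by blast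
    show "\<exists>\<delta>>0. \<forall>x\<in>X. \<forall>y\<in>X. dist x y < \<delta> \<longrightarrow> mean_dist T x y < ereal \<epsilon>"
    proof (intro exI conjI ballI impI)
      fix x y assume xy: "x \<in> X" "y \<in> X" "dist x y < \<delta>"
      then obtain n where n: "(T ^^ n) x \<in> ball z r" "(T ^^ n) y \<in> ball z r"
        using \<delta>(2) by blast
      have "mean_dist T x y \<le> mean_dist T ((T ^^ n) x) ((T ^^ n) y)"
        by (rule mean_dist_le_funpow)
      also have "\<dots> \<le> mean_dist T z ((T ^^ n) x) + mean_dist T z ((T ^^ n) y)"
        using mean_dist_triangle mean_dist_commute by metis
      also have "\<dots> \<le> ereal (\<epsilon> / 4) + ereal (\<epsilon> / 4)"
        using n xy inv by (intro add_mono zr) auto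
      also have "\<dots> < ereal \<epsilon>"
        using \<open>\<epsilon> > 0\<close> by simp
      finally show "mean_dist T x y < ereal \<epsilon>" .
    qed (rule \<delta>(1))
  qed
  then show "mean_equicontinuous X T \<or> mean_sensitive X T" by blast
  \<comment> \<open>On the empty set both properties hold vacuously. Otherwise the sensitivity
    constant is taken as the tolerance in mean equicontinuity, and the resulting
    \<open>\<delta>\<close> as the radius in sensitivity at \<open>x\<close>.\<close>
  show "X \<noteq> {} \<longrightarrow> \<not> (mean_equicontinuous X T \<and> mean_sensitive X T)"
  proof (intro impI notI, elim conjE)
    assume ne: "X \<noteq> {}" and eq: "mean_equicontinuous X T" and sens: "mean_sensitive X T"
    from ne obtain x where x: "x \<in> X" by blast
    from sens obtain \<epsilon> where \<epsilon>: "\<epsilon> > 0"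
      "\<And>\<delta>. \<delta> > 0 \<Longrightarrow> \<exists>y \<in> ball x \<delta> \<inter> X. mean_dist T x y > ereal \<epsilon>"
      using x unfolding mean_sensitive_def by blast
    from eq obtain \<delta> where "\<delta> > 0"
      and "\<And>y. y \<in> X \<Longrightarrow> dist x y < \<delta> \<Longrightarrow> mean_dist T x y < ereal \<epsilon>"
      using x \<epsilon>(1) unfolding mean_equicontinuous_def by blast
    moreover from \<epsilon>(2)[OF \<open>\<delta> > 0\<close>] obtain y
      where "y \<in> X" "dist x y < \<delta>" "mean_dist T x y > ereal \<epsilon>"
      by auto
    ultimately show False
      using less_asym by blast
  qed
qed

end
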